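(* Let $d\ge 1$, let $M\ge 2$, and let $\pi$ and $\eta$ be probability distributions on $\mathbb{R}^d$ supported on the Euclidean ball $B_2(M)=\{x\in\mathbb{R}^d:\|x\|_2\le M\}$. Then $$\mathrm{KL}(f_\pi\|f_\eta)\le 5154\,(M^2\vee d)\,H^2(f_\pi,f_\eta).$$
   Context: For a probability distribution $\pi$ on $\mathbb{R}^d$, $f_\pi=\pi*\varphi$ denotes the Gaussian mixture density $f_\pi(x)=\int_{\mathbb{R}^d}\varphi(x-z)\,\pi(dz)$, where $\varphi(z)=(2\pi)^{-d/2}\exp(-\|z\|_2^2/2)$ is the density of $\mathcal{N}(0,I_d)$. For densities $f,g$: $\mathrm{KL}(f\|g)=\int f\log\frac{f}{g}$ (natural logarithm) and $H^2(f,g)=\int(\sqrt f-\sqrt g)^2$. Notation: $a\vee b=\max(a,b)$. *)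

theory Defs
  imports "HOL-Probability.Probability"
begin

definition gauss_density :: "'a::euclidean_space \<Rightarrow> real" where
  "gauss_density z = (2 * pi) powr (- (real DIM('a) / 2)) * exp (- (norm z)\<^sup>2 / 2)"

definition gauss_mixture :: "'a::euclidean_space measure \<Rightarrow> 'a \<Rightarrow> real" where
  "gauss_mixture \<mu> x = (\<integral>z. gauss_density (x - z) \<partial>\<mu>)"

text \<open>
  The divergence takes values in the extended reals: the real-valued Lebesgue integral is 0 for
  non-integrable integrands, which would make an upper bound on it vacuous there. The
  integrand is \<open>f log (f / g)\<close> with the usual conventions \<open>0 log (0 / b) = 0\<close> and
  \<open>a log (a / 0) = \<infinity>\<close> for \<open>a > 0\<close>. The map \<open>e2ennreal\<close> sends negative
  values to 0, so the two integrals below are those of the positive and the negative part. For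
  probability densities the integral of the negative part is finite, so the difference is
  never of the form \<open>\<infinity> - \<infinity>\<close>.
\<close>

definition KL_integrand :: "('a \<Rightarrow> real) \<Rightarrow> ('a \<Rightarrow> real) \<Rightarrow> 'a \<Rightarrow> ereal" where
  "KL_integrand f g x =
     (if f x = 0 then 0 else if g x = 0 then \<infinity> else ereal (f x * ln (f x / g x)))"

definition KL :: "('a::euclidean_space \<Rightarrow> real) \<Rightarrow> ('a \<Rightarrow> real) \<Rightarrow> ereal" where
  "KL f g = enn2ereal (\<integral>\<^sup>+x. e2ennreal (KL_integrand f g x) \<partial>lborel)
          - enn2ereal (\<integral>\<^sup>+x. e2ennreal (- KL_integrand f g x) \<partial>lborel)"

definition hellinger_sq :: "('a::euclidean_space \<Rightarrow> real) \<Rightarrow> ('a \<Rightarrow> real) \<Rightarrow> ennreal" where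
  "hellinger_sq f g = (\<integral>\<^sup>+x. ennreal ((sqrt (f x) - sqrt (g x))\<^sup>2) \<partial>lborel)"

lemma KL_eq_integral:
  fixes f g :: "'a::euclidean_space \<Rightarrow> real"
  assumes g: "\<And>x. g x > 0"
    and int: "integrable lborel (\<lambda>x. f x * ln (f x / g x))"
  shows "KL f g = ereal (\<integral>x. f x * ln (f x / g x) \<partial>lborel)"
proof -
  let ?h = "\<lambda>x. f x * ln (f x / g x)"
  have h: "KL_integrand f g x = ereal (?h x)" for x
    using g[of x] by (auto simp: KL_integrand_def)
  have pos: "(\<integral>\<^sup>+x. ennreal (?h x) \<partial>lborel) \<noteq> \<infinity>"
    and neg: "(\<integral>\<^sup>+x. ennreal (- ?h x) \<partial>lborel) \<noteq> \<infinity>"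
    using int by (auto simp: real_integrable_def)
  obtain a where a: "a \<ge> 0" "(\<integral>\<^sup>+x. ennreal (?h x) \<partial>lborel) = ennreal a"
    using pos by (cases "\<integral>\<^sup>+x. ennreal (?h x) \<partial>lborel") auto
  obtain b where b: "b \<ge> 0" "(\<integral>\<^sup>+x. ennreal (- ?h x) \<partial>lborel) = ennreal b"
    using neg by (cases "\<integral>\<^sup>+x. ennreal (- ?h x) \<partial>lborel") auto
  have "KL f g = ereal (a - b)"
    unfolding KL_def h uminus_ereal.simps(1) ennreal.abs_eq[symmetric] e2ennreal_ereal
    using a b by simp
  also have "a - b = (\<integral>x. ?h x \<partial>lborel)"
    unfolding real_lebesgue_integral_def[OF int] using a b by simp
  finally show ?thesis .
qed

lemma KL_eq_KL_divergence:
  fixes f g :: "'a::euclidean_space \<Rightarrow> real"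
  assumes f: "f \<in> borel_measurable borel" "\<And>x. f x \<ge> 0"
    and g: "g \<in> borel_measurable borel" "\<And>x. g x > 0"
    and int: "integrable lborel (\<lambda>x. f x * ln (f x / g x))"
  shows "KL f g = ereal (KL_divergence (exp 1) (density lborel g) (density lborel f))"
proof -
  have "KL_divergence (exp 1) (density lborel g) (density lborel f)
      = (\<integral>x. f x * log (exp 1) (f x / g x) \<partial>lborel)"
    using f g by (intro lborel.KL_density_density) (auto simp: less_imp_le less_imp_neq[symmetric])
  then show ?thesis
    using KL_eq_integral[OF g(2) int] by (simp add: log_def)
qed

end

theory Submission
  imports Defs
begin

text \<open>
  Write \<open>f\<close>, \<open>g\<close> for the two mixture densities, \<open>r = f / g\<close>, and \<open>m\<^sup>2 = max (M\<^sup>2) d\<close>. Since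
  \<open>f\<close> and \<open>g\<close> have the same total mass, the divergence is the integral of the nonnegative
  function \<open>q = f ln r - f + g\<close> (\<open>KL_eq_nn_integral_bregman_entropy\<close>), and this is compared with
  \<open>D = (sqrt f - sqrt g)\<^sup>2\<close>. Where \<open>r \<le> 4\<close>, \<open>q \<le> 5 D\<close>. Where \<open>r \<ge> 4\<close>, \<open>f \<le> 4 D\<close> and
  \<open>q \<le> f ln r\<close>, so only the factor \<open>ln r\<close> separates the two. As the mixing distributions live in
  a ball of radius \<open>M\<close>, \<open>ln r\<close> is \<open>2 M\<close>-Lipschitz and at most \<open>2 M norm x + M\<^sup>2 / 2\<close>. On the ball
  of radius \<open>R = 128 m\<close> this is of order \<open>M m \<le> m\<^sup>2\<close>, as wanted.

  Outside that ball \<open>ln r\<close> may be unbounded, and the region cannot be discarded as a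
  Gaussian tail: the Hellinger distance may be much smaller than the mass of the tail. Instead the
  overweight part \<open>{r \<ge> 4}\<close> of the tail is compared with the Hellinger integrand at points
  slightly closer to the origin. Moving inwards by at most \<open>1 / (4 M)\<close> keeps \<open>r\<close> above \<open>16 / 9\<close>,
  by the Lipschitz bound, hence keeps \<open>f \<le> 16 D\<close>; but at distance \<open>a\<close> from the origin it
  multiplies \<open>f\<close> by a factor exponential in \<open>a / M\<close>, because there \<open>f\<close> decays radially at
  rate about \<open>a\<close> (\<open>gauss_mixture_dilate_le_hellinger\<close>). That gain beats
  \<open>ln r \<le> 5 M a = 5 M\<^sup>2 (a / M)\<close>, leaving a bound of order \<open>M\<^sup>2\<close>.

  On each dyadic shell \<open>a \<le> norm x \<le> 2 a\<close> the inward motion is a dilation, whose Jacobian is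
  the \<open>d\<close>-th power of its factor and is absorbed by the gain because \<open>a\<^sup>2\<close> exceeds a multiple of
  \<open>d\<close> (\<open>nn_integral_overweight_shell_le\<close>). The shell bounds form a geometric series.
\<close>

section \<open>Gaussian mixtures\<close>

lemma gauss_density_pos: "0 < gauss_density z"
  by (simp add: gauss_density_def)

lemma gauss_density_le: "gauss_density z \<le> gauss_density (0 :: 'a)" for z :: "'a::euclidean_space"
  by (simp add: gauss_density_def)

lemma borel_measurable_gauss_density [measurable]: "gauss_density \<in> borel_measurable borel"
  unfolding gauss_density_def by measurable

lemma gauss_density_eq_prod:
  "gauss_density (x :: 'a::euclidean_space) = (\<Prod>b\<in>Basis. std_normal_density (x \<bullet> b))"
proof -
  have "(1 / sqrt (2 * pi)) ^ DIM('a) = (2 * pi) powr (- (real DIM('a) / 2))"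
  proof -
    have "1 / sqrt (2 * pi) = (2 * pi) powr (- 1 / 2)"
      using powr_minus_divide[of "2 * pi" "1 / 2"] by (simp add: powr_half_sqrt)
    then show ?thesis by (simp add: powr_power)
  qed
  moreover have "(\<Sum>b\<in>Basis. - (x \<bullet> b)\<^sup>2 / 2) = - (norm x)\<^sup>2 / 2"
    unfolding power2_norm_eq_inner euclidean_inner[of x x]
    by (simp add: sum_divide_distrib sum_negf power2_eq_square)
  ultimately show ?thesis
    unfolding std_normal_density_def gauss_density_def
    by (simp only: prod.distrib prod_constant flip: exp_sum[OF finite_Basis])
qed

lemma nn_integral_gauss_density:
  "(\<integral>\<^sup>+x. ennreal (gauss_density (x :: 'a::euclidean_space)) \<partial>lborel) = 1"
proof -
  have "(\<integral>\<^sup>+x. ennreal (gauss_density (x :: 'a)) \<partial>lborel)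
      = (\<integral>\<^sup>+x. (\<Prod>b\<in>Basis. ennreal (std_normal_density (x \<bullet> b))) \<partial>(lborel :: 'a measure))"
    by (simp add: gauss_density_eq_prod prod_ennreal)
  also have "\<dots> = (\<Prod>b\<in>(Basis :: 'a set). \<integral>\<^sup>+t. ennreal (std_normal_density t) \<partial>lborel)"
    by (rule nn_integral_lborel_prod) auto
  also have "(\<integral>\<^sup>+t. ennreal (std_normal_density t) \<partial>lborel) = 1"
    by (simp add: nn_integral_eq_integral)
  finally show ?thesis by simp
qed

lemma nn_integral_lborel_scaleR:
  fixes F :: "'a::euclidean_space \<Rightarrow> ennreal"
  assumes [measurable]: "F \<in> borel_measurable borel" and "c > 0"
  shows "(\<integral>\<^sup>+x. F x \<partial>lborel) = ennreal (c ^ DIM('a)) * (\<integral>\<^sup>+x. F (c *\<^sub>R x) \<partial>lborel)"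
proof -
  have "(\<integral>\<^sup>+x. F x \<partial>lborel)
      = (\<integral>\<^sup>+x. F x \<partial>density (distr lborel borel (\<lambda>x. 0 + c *\<^sub>R x)) (\<lambda>_. \<bar>c\<bar> ^ DIM('a)))"
    using assms by (subst lborel_affine[of c 0]) auto
  then show ?thesis
    using assms by (simp add: nn_integral_density nn_integral_distr nn_integral_cmult)
qed

lemma nn_integral_gauss_density_shift:
  "(\<integral>\<^sup>+x. ennreal (gauss_density (x - z)) \<partial>lborel) = (1::ennreal)" for z :: "'a::euclidean_space"
proof -
  have "(\<integral>\<^sup>+x. ennreal (gauss_density (x - z)) \<partial>lborel)
      = (\<integral>\<^sup>+x. ennreal (gauss_density (x - z)) \<partial>distr lborel borel ((+) z))"
    by (simp add: lborel_distr_plus)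
  then show ?thesis
    by (simp add: nn_integral_distr nn_integral_gauss_density)
qed

text \<open>Completing the square: moving the base point from \<open>y\<close> to \<open>x\<close> changes the kernel by a factor
  in which \<open>z\<close> enters only through the linear term \<open>(x - y) \<bullet> z\<close>, which is bounded by
  \<open>M * norm (x - y)\<close> on the support.\<close>
lemma gauss_density_change_base:
  "gauss_density (x - z)
     = gauss_density (y - z) * exp (((norm y)\<^sup>2 - (norm x)\<^sup>2) / 2 + (x - y) \<bullet> z)"
proof -
  have "- (norm (x - z))\<^sup>2 / 2 = - (norm (y - z))\<^sup>2 / 2 + (((norm y)\<^sup>2 - (norm x)\<^sup>2) / 2 + (x - y) \<bullet> z)"
    by (simp add: power2_norm_eq_inner inner_diff_left inner_diff_right inner_commute field_simps)
  then show ?thesis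
    by (simp add: gauss_density_def exp_add[symmetric])
qed

locale bounded_mixing_distribution = prob_space \<mu>
  for \<mu> :: "'a::euclidean_space measure" and M :: real +
  assumes sets_eq_borel [measurable_cong, simp]: "sets \<mu> = sets borel"
    and AE_cball: "AE z in \<mu>. z \<in> cball 0 M"
begin

lemma integrable_gauss_density: "integrable \<mu> (\<lambda>z. gauss_density (x - z))"
  by (rule integrable_const_bound[where B = "gauss_density (0 :: 'a)"])
    (auto simp: gauss_density_le gauss_density_pos less_imp_le)

lemma ennreal_gauss_mixture:
  "ennreal (gauss_mixture \<mu> x) = (\<integral>\<^sup>+z. ennreal (gauss_density (x - z)) \<partial>\<mu>)"
  unfolding gauss_mixture_def
  by (rule nn_integral_eq_integral[symmetric])
    (auto simp: integrable_gauss_density gauss_density_pos less_imp_le)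

lemma gauss_mixture_pos: "0 < gauss_mixture \<mu> x"
  unfolding gauss_mixture_def
  using integral_less_AE_space[of "\<lambda>_. 0" "\<lambda>z. gauss_density (x - z)"]
  by (simp add: integrable_gauss_density gauss_density_pos emeasure_space_1)

lemma borel_measurable_gauss_mixture [measurable]: "gauss_mixture \<mu> \<in> borel_measurable borel"
  unfolding gauss_mixture_def by measurable

lemma nn_integral_gauss_mixture: "(\<integral>\<^sup>+x. ennreal (gauss_mixture \<mu> x) \<partial>lborel) = 1"
proof -
  interpret pair_sigma_finite \<mu> "lborel :: 'a measure" ..
  have "(\<integral>\<^sup>+x. ennreal (gauss_mixture \<mu> x) \<partial>lborel)
      = (\<integral>\<^sup>+x. \<integral>\<^sup>+z. ennreal (gauss_density (x - z)) \<partial>\<mu> \<partial>lborel)"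
    by (simp add: ennreal_gauss_mixture)
  also have "\<dots> = (\<integral>\<^sup>+z. \<integral>\<^sup>+x. ennreal (gauss_density (x - z)) \<partial>lborel \<partial>\<mu>)"
    by (rule Fubini') measurable
  finally show ?thesis
    by (simp add: nn_integral_gauss_density_shift emeasure_space_1)
qed

text \<open>Integrating \<open>gauss_density_change_base\<close> over the ball compares the values of a mixture at any
  two points. The quadratic term of the exponent is the same in both bounds and so cancels in a
  likelihood ratio; only the linear term, which depends on \<open>M\<close>, survives there.\<close>
lemma
  shows gauss_mixture_le_change_base:
    "gauss_mixture \<mu> x
       \<le> gauss_mixture \<mu> y * exp (((norm y)\<^sup>2 - (norm x)\<^sup>2) / 2 + M * norm (x - y))" (is ?upper)
    and gauss_mixture_ge_change_base:
    "gauss_mixture \<mu> y * exp (((norm y)\<^sup>2 - (norm x)\<^sup>2) / 2 - M * norm (x - y))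
       \<le> gauss_mixture \<mu> x" (is ?lower)
proof -
  have inner: "\<bar>(x - y) \<bullet> z\<bar> \<le> M * norm (x - y)" if "z \<in> cball 0 M" for z
  proof -
    have "\<bar>(x - y) \<bullet> z\<bar> \<le> norm (x - y) * norm z" by (rule Cauchy_Schwarz_ineq2)
    also have "\<dots> \<le> norm (x - y) * M" using that by (intro mult_left_mono) auto
    finally show ?thesis by (simp add: mult.commute)
  qed
  have upper: "AE z in \<mu>. gauss_density (x - z)
      \<le> gauss_density (y - z) * exp (((norm y)\<^sup>2 - (norm x)\<^sup>2) / 2 + M * norm (x - y))"
    using AE_cball
  proof eventually_elim
    case (elim z)
    then show ?case
      unfolding gauss_density_change_base[of x z y]
      using inner[of z] by (intro mult_left_mono) (auto simp: gauss_density_pos less_imp_le)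
  qed
  have lower: "AE z in \<mu>.
      gauss_density (y - z) * exp (((norm y)\<^sup>2 - (norm x)\<^sup>2) / 2 - M * norm (x - y))
        \<le> gauss_density (x - z)"
    using AE_cball
  proof eventually_elim
    case (elim z)
    then show ?case
      unfolding gauss_density_change_base[of x z y]
      using inner[of z] by (intro mult_left_mono) (auto simp: gauss_density_pos less_imp_le)
  qed
  show ?upper
    unfolding gauss_mixture_def integral_mult_left_zero[symmetric]
    by (intro integral_mono_AE upper integrable_mult_left integrable_gauss_density)
  show ?lower
    unfolding gauss_mixture_def integral_mult_left_zero[symmetric]
    by (intro integral_mono_AE lower integrable_mult_left integrable_gauss_density)
qed

end

section \<open>Pointwise comparison of divergence and Hellinger distance\<close>

text \<open>The Bregman divergence of \<open>t ln t\<close>. Adding the terms \<open>b - a\<close>, which integrate to 0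
  for densities, makes the integrand of the divergence nonnegative and of second order in
  \<open>a - b\<close>, like the Hellinger integrand.\<close>
definition bregman_entropy :: "real \<Rightarrow> real \<Rightarrow> real" where
  "bregman_entropy a b = a * ln (a / b) - a + b"

lemma bregman_entropy_nonneg:
  assumes "a > 0" "b > 0"
  shows "0 \<le> bregman_entropy a b"
proof -
  have "ln (b / a) \<le> b / a - 1" using assms by (intro ln_le_minus_one) auto
  then have "a * ln (b / a) \<le> b - a" using assms by (simp add: field_simps)
  then show ?thesis using assms by (simp add: bregman_entropy_def ln_div algebra_simps)
qed

text \<open>Integrability of \<open>f ln (f / g)\<close> is not assumed, so the identity \<open>h + g = q + f\<close> with
  \<open>h = f ln (f / g)\<close> is first rearranged into one between nonnegative functions,
  \<open>h\<^sup>+ + g = q + h\<^sup>- + f\<close>. Only the integrals of \<open>f\<close>, \<open>g\<close> and \<open>h\<^sup>- \<le> g\<close> have to be finite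
  to cancel them.\<close>
lemma KL_eq_nn_integral_bregman_entropy:
  fixes f g :: "'a::euclidean_space \<Rightarrow> real"
  assumes [measurable]: "f \<in> borel_measurable borel" "g \<in> borel_measurable borel"
    and f: "\<And>x. f x > 0" and g: "\<And>x. g x > 0"
    and f1: "(\<integral>\<^sup>+x. ennreal (f x) \<partial>lborel) = 1"
    and g1: "(\<integral>\<^sup>+x. ennreal (g x) \<partial>lborel) = 1"
  shows "KL f g = enn2ereal (\<integral>\<^sup>+x. ennreal (bregman_entropy (f x) (g x)) \<partial>lborel)"
proof -
  define h where "h = (\<lambda>x. f x * ln (f x / g x))"
  define q where "q = (\<lambda>x. bregman_entropy (f x) (g x))"
  have [measurable]: "h \<in> borel_measurable borel" "q \<in> borel_measurable borel"
    unfolding h_def q_def bregman_entropy_def by measurable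
  have q0: "0 \<le> q x" for x
    using bregman_entropy_nonneg[OF f g] by (simp add: q_def)
  have hq: "h x + g x = q x + f x" for x by (simp add: h_def q_def bregman_entropy_def)
  have eq: "ennreal (h x) + ennreal (g x) = ennreal (q x) + ennreal (- h x) + ennreal (f x)" for x
  proof (cases "h x \<ge> 0")
    case True
    then show ?thesis
      using hq[of x] q0[of x] f[of x] g[of x]
      by (simp add: ennreal_neg less_imp_le flip: ennreal_plus)
  next
    case False
    then show ?thesis
      using hq[of x] q0[of x] f[of x] g[of x]
      by (simp add: ennreal_neg less_imp_le flip: ennreal_plus)
  qed
  define p n Q where "p = (\<integral>\<^sup>+x. ennreal (h x) \<partial>lborel)"
    and "n = (\<integral>\<^sup>+x. ennreal (- h x) \<partial>lborel)" and "Q = (\<integral>\<^sup>+x. ennreal (q x) \<partial>lborel)"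
  have "n \<le> (\<integral>\<^sup>+x. ennreal (g x) \<partial>lborel)"
    unfolding n_def
  proof (intro nn_integral_mono ennreal_leI)
    fix x show "- h x \<le> g x" using hq[of x] q0[of x] f[of x] by linarith
  qed
  then have n: "n < top" using g1 by (simp add: le_less_trans[of n 1])
  have "p + 1 = (\<integral>\<^sup>+x. ennreal (h x) + ennreal (g x) \<partial>lborel)"
    unfolding p_def g1[symmetric] by (simp add: nn_integral_add)
  also have "\<dots> = Q + n + 1"
    unfolding eq f1[symmetric] Q_def n_def by (simp add: nn_integral_add)
  finally have "p = Q + n"
    using ennreal_add_left_cancel[of 1 p "Q + n"] by (simp add: add.commute)
  moreover obtain b where b: "b \<ge> 0" "n = ennreal b"
    using n by (cases n) auto
  ultimately have "enn2ereal p - enn2ereal n = enn2ereal Q"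
    by (cases Q) (auto simp: plus_ennreal.rep_eq)
  moreover have "KL_integrand f g x = ereal (h x)" for x
    using f[of x] g[of x] by (simp add: KL_integrand_def h_def)
  ultimately show ?thesis
    unfolding KL_def p_def n_def Q_def q_def by simp
qed

text \<open>With \<open>s = sqrt a\<close> and \<open>v = sqrt b\<close>, the bound \<open>ln (s / v) \<le> s / v - 1\<close> leaves
  \<open>(s - v)\<^sup>2 (2 s / v + 1)\<close>, and \<open>s \<le> 2 v\<close>.\<close>
lemma bregman_entropy_le_hellinger:
  assumes a: "a > 0" and b: "b > 0" and ab: "a \<le> 4 * b"
  shows "bregman_entropy a b \<le> 5 * (sqrt a - sqrt b)\<^sup>2"
proof -
  define s v where "s = sqrt a" and "v = sqrt b"
  have s: "s > 0" "s\<^sup>2 = a" and v: "v > 0" "v\<^sup>2 = b" using a b by (auto simp: s_def v_def)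
  have "s\<^sup>2 \<le> (2 * v)\<^sup>2" using ab s v by (simp add: power_mult_distrib)
  then have sv: "s \<le> 2 * v" by (rule power2_le_imp_le) (use v in auto)
  have "ln (a / b) = 2 * ln (s / v)"
    using s v by (simp add: ln_div ln_realpow flip: s(2) v(2))
  also have "\<dots> \<le> 2 * (s / v - 1)"
    using s v ln_le_minus_one[of "s / v"] by simp
  finally have "a * ln (a / b) \<le> a * (2 * (s / v - 1))" using a by (intro mult_left_mono) auto
  then have "bregman_entropy a b \<le> s\<^sup>2 * (2 * (s / v - 1)) - s\<^sup>2 + v\<^sup>2"
    unfolding bregman_entropy_def using s v by simp
  also have "\<dots> = (s - v)\<^sup>2 * (2 * (s / v) + 1)"
    using v by (simp add: field_simps power2_eq_square)
  also have "\<dots> \<le> (s - v)\<^sup>2 * 5"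
    using sv v by (intro mult_left_mono) (auto simp: field_simps)
  finally show ?thesis by (simp add: s_def v_def mult.commute)
qed

text \<open>Once \<open>sqrt a\<close> exceeds \<open>c sqrt b\<close> with \<open>c > 1\<close>, the difference \<open>sqrt a - sqrt b\<close> is a fixed
  fraction of \<open>sqrt a\<close>. This is used with \<open>c = 2\<close>, \<open>k = 2\<close> for the points where \<open>a \<ge> 4 b\<close> and with
  \<open>c = 4 / 3\<close>, \<open>k = 4\<close> after the inward motion.\<close>
lemma le_hellinger_of_ratio_ge:
  assumes "b > 0" "k > 0" "c > 0" "(1 - 1 / c) * k \<ge> 1" "a \<ge> c\<^sup>2 * b"
  shows "a \<le> k\<^sup>2 * (sqrt a - sqrt b)\<^sup>2"
proof -
  have a: "a > 0" using assms by (smt (verit) zero_less_power mult_pos_pos)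
  have "c * sqrt b = sqrt (c\<^sup>2 * b)" using assms by (simp add: real_sqrt_mult)
  also have "\<dots> \<le> sqrt a" using assms by simp
  finally have "sqrt b \<le> sqrt a / c" using assms by (simp add: field_simps)
  then have "(1 - 1 / c) * sqrt a \<le> sqrt a - sqrt b" by (simp add: algebra_simps)
  then have "k * ((1 - 1 / c) * sqrt a) \<le> k * (sqrt a - sqrt b)"
    using assms by (intro mult_left_mono) auto
  moreover have "1 * sqrt a \<le> ((1 - 1 / c) * k) * sqrt a"
    using assms a by (intro mult_right_mono) auto
  ultimately have "sqrt a \<le> k * (sqrt a - sqrt b)" by (simp add: algebra_simps)
  then have "(sqrt a)\<^sup>2 \<le> (k * (sqrt a - sqrt b))\<^sup>2" using a by (intro power_mono) auto
  then show ?thesis using a by (simp add: power_mult_distrib)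
qed

section \<open>The likelihood ratio of two mixtures\<close>

locale mixture_pair =
  P: bounded_mixing_distribution \<pi> M + E: bounded_mixing_distribution \<eta> M
  for \<pi> \<eta> :: "'a::euclidean_space measure" and M :: real +
  assumes M_ge_2: "M \<ge> 2"
begin

abbreviation f where "f \<equiv> gauss_mixture \<pi>"
abbreviation g where "g \<equiv> gauss_mixture \<eta>"

lemma ratio_le_change_base: "f x / g x \<le> f y / g y * exp (2 * M * norm (x - y))"
proof -
  define s where "s = ((norm y)\<^sup>2 - (norm x)\<^sup>2) / 2"
  define t where "t = M * norm (x - y)"
  have "f x / g x \<le> (f y * exp (s + t)) / (g y * exp (s - t))"
    using P.gauss_mixture_le_change_base[of x y] E.gauss_mixture_ge_change_base[of y x]
      P.gauss_mixture_pos[of x] E.gauss_mixture_pos[of y]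
    by (intro frac_le) (auto simp: s_def t_def)
  also have "\<dots> = f y / g y * exp (2 * t)"
    by (simp add: exp_add exp_diff exp_double power2_eq_square)
  finally show ?thesis by (simp add: t_def mult.assoc)
qed

text \<open>At the origin, \<open>norm z \<le> M\<close> confines both mixtures to within a factor
  \<open>exp (- M\<^sup>2 / 2)\<close> of the peak of the Gaussian; the Lipschitz bound carries this to \<open>x\<close>.\<close>
lemma ln_ratio_le: "ln (f x / g x) \<le> 2 * M * norm x + M\<^sup>2 / 2"
proof -
  have pos: "f x > 0" "g x > 0" "f 0 > 0" "g 0 > 0"
    by (auto simp: P.gauss_mixture_pos E.gauss_mixture_pos)
  have f0: "f 0 \<le> gauss_density (0 :: 'a)"
  proof -
    have "f 0 \<le> (\<integral>z. gauss_density (0 :: 'a) \<partial>\<pi>)"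
      unfolding gauss_mixture_def
      by (intro integral_mono P.integrable_gauss_density) (auto simp: gauss_density_le)
    then show ?thesis by (simp add: P.prob_space)
  qed
  have g0: "gauss_density (0 :: 'a) * exp (- M\<^sup>2 / 2) \<le> g 0"
  proof -
    have "(\<integral>z. gauss_density (0 :: 'a) * exp (- M\<^sup>2 / 2) \<partial>\<eta>) \<le> g 0"
      unfolding gauss_mixture_def
    proof (intro integral_mono_AE E.integrable_gauss_density)
      show "AE z in \<eta>. gauss_density (0 :: 'a) * exp (- M\<^sup>2 / 2) \<le> gauss_density (0 - z)"
        using E.AE_cball
      proof eventually_elim
        case (elim z)
        then have "(norm z)\<^sup>2 \<le> M\<^sup>2" by (intro power_mono) auto
        then show ?case by (simp add: gauss_density_def)
      qed
    qed simp
    then show ?thesis by (simp add: E.prob_space)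
  qed
  have "f 0 / g 0 \<le> gauss_density (0 :: 'a) / (gauss_density (0 :: 'a) * exp (- M\<^sup>2 / 2))"
    using f0 g0 pos gauss_density_pos[of "0 :: 'a"] by (intro frac_le) auto
  also have "\<dots> = exp (M\<^sup>2 / 2)"
    using gauss_density_pos[of "0 :: 'a"] by (simp add: exp_minus field_simps)
  finally have "f 0 / g 0 \<le> exp (M\<^sup>2 / 2)" .
  then have "f 0 / g 0 * exp (2 * M * norm x) \<le> exp (M\<^sup>2 / 2) * exp (2 * M * norm x)"
    by (intro mult_right_mono) auto
  then have "f x / g x \<le> exp (2 * M * norm x + M\<^sup>2 / 2)"
    using ratio_le_change_base[of x 0] by (simp add: exp_add mult.commute)
  then show ?thesis
    using pos by (metis divide_pos_pos exp_gt_zero ln_exp ln_le_cancel_iff)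
qed

section \<open>The tail\<close>

definition overweight_shell :: "real \<Rightarrow> 'a set" where
  "overweight_shell a = {x. a \<le> norm x \<and> norm x \<le> 2 * a \<and> 4 * g x \<le> f x}"

lemma overweight_shell_measurable [measurable]: "overweight_shell a \<in> sets borel"
  unfolding overweight_shell_def by measurable

text \<open>The factor \<open>l\<close> is chosen so that on the shell the dilation displaces points by between
  \<open>1 / (9 * M)\<close> and \<open>1 / (4 * M)\<close>: little enough for the likelihood ratio to change by a
  bounded factor, and enough for \<open>f\<close>, whose logarithm decreases radially with slope at least
  \<open>norm y - M \<ge> a / 2\<close>, to gain \<open>exp (a / (18 * M))\<close>.\<close>
lemma gauss_mixture_dilate_le_hellinger:
  assumes a: "a \<ge> 64 * M" and l: "l = 1 + 1 / (8 * M * a)"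
    and y: "l *\<^sub>R y \<in> overweight_shell a"
  shows "f (l *\<^sub>R y) \<le> 16 * exp (- a / (18 * M)) * (sqrt (f y) - sqrt (g y))\<^sup>2"
proof -
  define \<epsilon> where "\<epsilon> = 1 / (8 * M * a)"
  define s where "s = norm y"
  have M: "M \<ge> 2" and a0: "a \<ge> 128" using M_ge_2 a by auto
  have "M * a \<ge> 2 * 128" using M a0 by (intro mult_mono) auto
  then have \<epsilon>: "0 < \<epsilon>" "\<epsilon> \<le> 1 / 8" using M a0 by (auto simp: \<epsilon>_def field_simps)
  have \<epsilon>a: "\<epsilon> * a = 1 / (8 * M)" using a0 by (simp add: \<epsilon>_def)
  have l': "l = 1 + \<epsilon>" by (simp add: l \<epsilon>_def)
  have ly: "norm (l *\<^sub>R y) = l * s" using \<epsilon> by (simp add: l' s_def)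
  have diff: "norm (l *\<^sub>R y - y) = \<epsilon> * s"
    using \<epsilon> by (simp add: l' s_def scaleR_add_left)
  have shell: "a \<le> l * s" "l * s \<le> 2 * a" "4 * g (l *\<^sub>R y) \<le> f (l *\<^sub>R y)"
    using y by (simp_all add: overweight_shell_def ly del: norm_scaleR)
  have s0: "0 \<le> s" by (simp add: s_def)
  have "l * s \<le> 9 / 8 * s" using \<epsilon> s0 by (intro mult_right_mono) (auto simp: l')
  then have s_ge: "s \<ge> 8 / 9 * a" using shell by simp
  have "1 * s \<le> l * s" using \<epsilon> s0 by (intro mult_right_mono) (auto simp: l')
  then have s_le: "s \<le> 2 * a" using shell by simp
  have \<epsilon>s_ge: "\<epsilon> * s \<ge> 1 / (9 * M)"
  proof -
    have "\<epsilon> * (8 / 9 * a) \<le> \<epsilon> * s" using \<epsilon> s_ge by (intro mult_left_mono) auto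
    then show ?thesis using \<epsilon>a by (simp add: mult.left_commute)
  qed
  have \<epsilon>s_le: "\<epsilon> * s \<le> 1 / (4 * M)"
  proof -
    have "\<epsilon> * s \<le> \<epsilon> * (2 * a)" using \<epsilon> s_le by (intro mult_left_mono) auto
    then show ?thesis using \<epsilon>a by (simp add: mult.left_commute)
  qed
  have pos: "f y > 0" "g y > 0" "g (l *\<^sub>R y) > 0"
    by (auto simp: P.gauss_mixture_pos E.gauss_mixture_pos)
  \<comment> \<open>The dilation moves \<open>y\<close> by at most \<open>1 / (4 * M)\<close>, so the likelihood ratio stays above
    \<open>4 * exp (- 1 / 2) \<ge> (4 / 3)\<^sup>2\<close>.\<close>
  have "4 \<le> f (l *\<^sub>R y) / g (l *\<^sub>R y)" using shell pos by (simp add: field_simps)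
  also have "\<dots> \<le> f y / g y * exp (2 * M * (\<epsilon> * s))"
    using ratio_le_change_base[of "l *\<^sub>R y" y] by (simp add: diff)
  also have "\<dots> \<le> f y / g y * exp (1 / 2)"
    using \<epsilon>s_le M pos by (intro mult_left_mono) (auto simp: field_simps)
  also have "\<dots> \<le> f y / g y * (9 / 4)"
  proof (intro mult_left_mono)
    have "exp (1 / 2) \<le> (1::real) + 1 / 2 + (1 / 2)\<^sup>2"
      by (rule exp_bound) auto
    then show "exp (1 / 2) \<le> (9 / 4 :: real)" by (simp add: power2_eq_square)
  qed (use pos in auto)
  finally have "(4 / 3)\<^sup>2 * g y \<le> f y" using pos by (simp add: field_simps power2_eq_square)
  then have fD: "f y \<le> 4\<^sup>2 * (sqrt (f y) - sqrt (g y))\<^sup>2"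
    by (intro le_hellinger_of_ratio_ge[where c = "4 / 3"]) (use pos in auto)
  have "f (l *\<^sub>R y) \<le> f y * exp ((s\<^sup>2 - (l * s)\<^sup>2) / 2 + M * (\<epsilon> * s))"
    using P.gauss_mixture_le_change_base[of "l *\<^sub>R y" y] by (simp add: diff ly flip: s_def del: norm_scaleR)
  also have "\<dots> \<le> f y * exp (- a / (18 * M))"
  proof (intro mult_left_mono iffD2[OF exp_le_cancel_iff])
    have "(s\<^sup>2 - (l * s)\<^sup>2) / 2 + M * (\<epsilon> * s) = - (\<epsilon> * s) * (s - M) - (\<epsilon> * s)\<^sup>2 / 2"
      by (simp add: l' power2_eq_square field_simps)
    also have "\<dots> \<le> - (\<epsilon> * s) * (s - M)" by simp
    also have "\<dots> \<le> - (1 / (9 * M)) * (a / 2)"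
    proof -
      have "(1 / (9 * M)) * (a / 2) \<le> (\<epsilon> * s) * (s - M)"
        using \<epsilon>s_ge s_ge a M \<epsilon> s0 by (intro mult_mono) auto
      then show ?thesis by simp
    qed
    also have "\<dots> = - a / (18 * M)" by simp
    finally show "(s\<^sup>2 - (l * s)\<^sup>2) / 2 + M * (\<epsilon> * s) \<le> - a / (18 * M)" .
  qed (use pos in auto)
  also have "\<dots> \<le> (4\<^sup>2 * (sqrt (f y) - sqrt (g y))\<^sup>2) * exp (- a / (18 * M))"
    using fD by (intro mult_right_mono) auto
  finally show ?thesis by (simp add: algebra_simps)
qed

text \<open>The change of variables \<open>x = l *\<^sub>R y\<close> costs the Jacobian \<open>l ^ DIM('a)\<close>, at most
  \<open>exp (DIM('a) / (8 * M * a))\<close>. The hypothesis on the dimension turns this into a small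
  fraction of the exponential gain.\<close>
lemma nn_integral_overweight_shell_le:
  assumes a: "a \<ge> 64 * M" and d: "a\<^sup>2 \<ge> 64 * real DIM('a)"
  shows "(\<integral>\<^sup>+x. ennreal (f x) * indicator (overweight_shell a) x \<partial>lborel)
    \<le> ennreal (16 * exp (- a / (32 * M))) * hellinger_sq f g"
proof -
  define l where "l = 1 + 1 / (8 * M * a)"
  define D where "D = (\<lambda>y. (sqrt (f y) - sqrt (g y))\<^sup>2)"
  have [measurable]: "D \<in> borel_measurable borel" unfolding D_def by measurable
  have M: "M \<ge> 2" and a0: "a \<ge> 128" using M_ge_2 a by auto
  have l0: "l > 0" using M a0 by (simp add: l_def add_pos_nonneg)
  have le: "ennreal (f (l *\<^sub>R y)) * indicator (overweight_shell a) (l *\<^sub>R y)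
      \<le> ennreal (16 * exp (- a / (18 * M))) * ennreal (D y)" for y
    using gauss_mixture_dilate_le_hellinger[OF a l_def, of y]
    by (auto simp: indicator_def D_def simp flip: ennreal_mult intro!: ennreal_leI)
  have "l ^ DIM('a) \<le> exp (1 / (8 * M * a)) ^ DIM('a)"
    unfolding l_def using M a0 by (intro power_mono exp_ge_add_one_self) auto
  also have "\<dots> = exp (real DIM('a) / (8 * M * a))"
    by (simp flip: exp_of_nat_mult)
  also have "\<dots> \<le> exp (a / (512 * M))"
    using d M a0 by (simp add: field_simps power2_eq_square)
  finally have "l ^ DIM('a) * exp (- a / (18 * M)) \<le> exp (a / (512 * M)) * exp (- a / (18 * M))"
    by (intro mult_right_mono) auto
  also have "\<dots> = exp (a / M * (1 / 512 - 1 / 18))"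
    by (simp add: mult_exp_exp algebra_simps)
  also have "\<dots> \<le> exp (a / M * (- 1 / 32))"
    using M a0 by (intro iffD2[OF exp_le_cancel_iff] mult_left_mono) auto
  finally have gain: "l ^ DIM('a) * exp (- a / (18 * M)) \<le> exp (- a / (32 * M))" by (simp add: mult.commute)
  have "(\<integral>\<^sup>+x. ennreal (f x) * indicator (overweight_shell a) x \<partial>lborel)
      = ennreal (l ^ DIM('a))
        * (\<integral>\<^sup>+y. ennreal (f (l *\<^sub>R y)) * indicator (overweight_shell a) (l *\<^sub>R y) \<partial>lborel)"
    using l0 by (intro nn_integral_lborel_scaleR) measurable
  also have "\<dots> \<le> ennreal (l ^ DIM('a))
        * (\<integral>\<^sup>+y. ennreal (16 * exp (- a / (18 * M))) * ennreal (D y) \<partial>lborel)"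
    by (intro mult_left_mono nn_integral_mono le) auto
  also have "\<dots> = ennreal (l ^ DIM('a) * (16 * exp (- a / (18 * M)))) * hellinger_sq f g"
    using l0 by (simp add: nn_integral_cmult hellinger_sq_def D_def ennreal_mult mult.assoc)
  also have "\<dots> \<le> ennreal (16 * exp (- a / (32 * M))) * hellinger_sq f g"
    using gain by (intro mult_right_mono ennreal_leI) auto
  finally show ?thesis .
qed

section \<open>Summation over the shells\<close>

text \<open>Three cases: comparable densities, an overweight point in the ball of radius \<open>R\<close>, and an
  overweight point outside it. The last lies in the shell of index \<open>\<lfloor>log 2 (norm x / R)\<rfloor>\<close>.\<close>
lemma bregman_entropy_mixture_le:
  fixes R :: real and a :: "nat \<Rightarrow> real" and x :: 'a
  assumes R: "R \<ge> M" and a: "\<And>k. a k = 2 ^ k * R"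
  defines "D \<equiv> (sqrt (f x) - sqrt (g x))\<^sup>2"
  shows "ennreal (bregman_entropy (f x) (g x))
    \<le> ennreal ((5 + 4 * (2 * M * R + M\<^sup>2 / 2)) * D)
      + (\<Sum>k. ennreal (5 * M * a k) * (ennreal (f x) * indicator (overweight_shell (a k)) x))"
    (is "_ \<le> ennreal ?inner + (\<Sum>k. ?tail k)")
proof -
  have M: "M \<ge> 2" and R0: "R > 0" using M_ge_2 R by auto
  have pos: "f x > 0" "g x > 0" by (auto simp: P.gauss_mixture_pos E.gauss_mixture_pos)
  have D0: "D \<ge> 0" by (simp add: D_def)
  have L0: "0 \<le> 2 * M * R + M\<^sup>2 / 2" using M R0 by simp
  consider "f x \<le> 4 * g x" | "4 * g x \<le> f x" "norm x < R" | "4 * g x \<le> f x" "R \<le> norm x"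
    by linarith
  then show ?thesis
  proof cases
    case 1
    then have "bregman_entropy (f x) (g x) \<le> 5 * D"
      unfolding D_def using pos by (intro bregman_entropy_le_hellinger) auto
    also have "\<dots> \<le> ?inner" using D0 L0 by (intro mult_right_mono) auto
    finally have "ennreal (bregman_entropy (f x) (g x)) \<le> ennreal ?inner" by (rule ennreal_leI)
    then show ?thesis by (rule add_increasing2[rotated]) simp
  next
    case 2
    have "bregman_entropy (f x) (g x) \<le> f x * ln (f x / g x)"
      using 2 pos by (simp add: bregman_entropy_def)
    also have "\<dots> \<le> f x * (2 * M * R + M\<^sup>2 / 2)"
    proof (intro mult_left_mono order_trans[OF ln_ratio_le] add_right_mono)
      show "norm x \<le> R" using 2 by simp
    qed (use pos M in auto)
    also have "\<dots> \<le> (2\<^sup>2 * D) * (2 * M * R + M\<^sup>2 / 2)"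
      unfolding D_def
      by (intro mult_right_mono le_hellinger_of_ratio_ge[where c = 2]) (use 2 pos L0 in auto)
    also have "\<dots> \<le> ?inner" using D0 by (simp add: algebra_simps)
    finally have "ennreal (bregman_entropy (f x) (g x)) \<le> ennreal ?inner" by (rule ennreal_leI)
    then show ?thesis by (rule add_increasing2[rotated]) simp
  next
    case 3
    define k where "k = nat \<lfloor>log 2 (norm x / R)\<rfloor>"
    have nx: "norm x > 0" using 3 R0 by linarith
    have k: "real k \<le> log 2 (norm x / R)" "log 2 (norm x / R) \<le> real k + 1"
    proof -
      have "log 2 (norm x / R) \<ge> 0" using 3 R0 nx by simp
      then show "real k \<le> log 2 (norm x / R)" "log 2 (norm x / R) \<le> real k + 1"
        unfolding k_def by linarith+
    qed
    have "2 ^ k \<le> norm x / R"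
      using k(1) nx R0 by (simp add: le_log_iff powr_realpow)
    then have lo: "a k \<le> norm x" using R0 by (simp add: a field_simps)
    have "norm x / R \<le> 2 powr (real k + 1)"
      using k(2) nx R0 by (simp add: log_le_iff)
    then have "norm x / R \<le> 2 * 2 ^ k"
      by (simp add: powr_add powr_realpow mult.commute)
    then have hi: "norm x \<le> 2 * a k" using R0 by (simp add: a field_simps)
    have mem: "x \<in> overweight_shell (a k)" using 3 lo hi by (simp add: overweight_shell_def)
    have "1 * R \<le> a k" unfolding a using R0 by (intro mult_right_mono) auto
    then have Mak: "M \<le> a k" using R by simp
    have "bregman_entropy (f x) (g x) \<le> f x * ln (f x / g x)"
      using 3 pos by (simp add: bregman_entropy_def)
    also have "\<dots> \<le> f x * (5 * M * a k)"
    proof (intro mult_left_mono order_trans[OF ln_ratio_le])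
      have "2 * M * norm x \<le> 2 * M * (2 * a k)" using hi M by (intro mult_left_mono) auto
      moreover have "M * M \<le> M * a k" using Mak M by (intro mult_left_mono) auto
      moreover have "0 \<le> M * M" by simp
      ultimately show "2 * M * norm x + M\<^sup>2 / 2 \<le> 5 * M * a k"
        unfolding power2_eq_square by linarith
    qed (use pos in auto)
    finally have "ennreal (bregman_entropy (f x) (g x)) \<le> ?tail k"
      using mem pos M Mak by (auto simp: mult.commute simp flip: ennreal_mult intro!: ennreal_leI)
    also have "\<dots> = sum ?tail {k}" by simp
    also have "\<dots> \<le> (\<Sum>k. ?tail k)" by (intro sum_le_suminf) auto
    finally show ?thesis by (rule add_increasing[rotated]) simp
  qed
qed

lemma nn_integral_bregman_entropy_mixture_le:
  fixes m :: real
  assumes m: "m\<^sup>2 = max (M\<^sup>2) (real DIM('a))" "m \<ge> 0"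
  shows "(\<integral>\<^sup>+x. ennreal (bregman_entropy (f x) (g x)) \<partial>lborel)
    \<le> ennreal (5154 * m\<^sup>2) * hellinger_sq f g"
proof -
  define R where "R = 128 * m"
  define a :: "nat \<Rightarrow> real" where "a k = 2 ^ k * R" for k
  define D where "D = (\<lambda>y. (sqrt (f y) - sqrt (g y))\<^sup>2)"
  define C where "C = 5 + 4 * (2 * M * R + M\<^sup>2 / 2)"
  let ?H = "hellinger_sq f g"
  have [measurable]: "D \<in> borel_measurable borel" unfolding D_def by measurable
  have M: "M \<ge> 2" by (rule M_ge_2)
  have "M\<^sup>2 \<le> m\<^sup>2" using m by simp
  then have Mm: "M \<le> m" using m(2) by (rule power2_le_imp_le)
  have R: "R \<ge> 128 * M" using Mm by (simp add: R_def)
  have aR: "R \<le> a k" for k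
  proof -
    have "1 * R \<le> 2 ^ k * R" using R M by (intro mult_right_mono) auto
    then show ?thesis by (simp add: a_def)
  qed
  have shell: "ennreal (5 * M * a k)
      * (\<integral>\<^sup>+x. ennreal (f x) * indicator (overweight_shell (a k)) x \<partial>lborel)
    \<le> ennreal (1280 * M\<^sup>2 * (1 / 2) ^ k) * ?H" for k
  proof -
    define t where "t = a k / M"
    have ak: "a k \<ge> 128 * M" using aR[of k] R by simp
    have t: "t > 0" using ak M by (simp add: t_def)
    have dim: "64 * real DIM('a) \<le> (a k)\<^sup>2"
    proof -
      have "64 * real DIM('a) \<le> 64 * m\<^sup>2" using m by simp
      also have "\<dots> \<le> R\<^sup>2" by (simp add: R_def power_mult_distrib)
      also have "\<dots> \<le> (a k)\<^sup>2" using aR[of k] R M by (intro power_mono) auto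
      finally show ?thesis .
    qed
    \<comment> \<open>From \<open>exp u \<ge> u\<^sup>2 / 2\<close> at \<open>u = t / 32\<close>: the factor \<open>1 / t\<close> left after absorbing the
      weight \<open>t\<close> makes the sum over the shells geometric.\<close>
    have "(t / 32)\<^sup>2 / 2 \<le> exp (t / 32)"
      using exp_lower_Taylor_quadratic[of "t / 32"] t by simp
    then have "t\<^sup>2 \<le> 2048 * exp (t / 32)" by (simp add: power_divide)
    then have expt: "t * exp (- t / 32) \<le> 2048 / t"
      using t by (simp add: exp_minus field_simps power2_eq_square)
    have "5 * M * a k * (16 * exp (- a k / (32 * M))) = 80 * M\<^sup>2 * (t * exp (- t / 32))"
      using M by (simp add: t_def power2_eq_square)
    also have "\<dots> \<le> 80 * M\<^sup>2 * (2048 / t)" using expt by (intro mult_left_mono) auto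
    also have "\<dots> \<le> 80 * M\<^sup>2 * (2048 / (128 * 2 ^ k))"
    proof (intro mult_left_mono divide_left_mono)
      have "2 ^ k * (128 * M) \<le> 2 ^ k * R" using R by (intro mult_left_mono) auto
      then show "128 * 2 ^ k \<le> t" using M by (simp add: t_def a_def field_simps)
    qed (use t in auto)
    also have "\<dots> = 1280 * M\<^sup>2 * (1 / 2) ^ k" by (simp add: power_divide field_simps)
    finally have const: "5 * M * a k * (16 * exp (- a k / (32 * M))) \<le> 1280 * M\<^sup>2 * (1 / 2) ^ k" .
    have "ennreal (5 * M * a k)
        * (\<integral>\<^sup>+x. ennreal (f x) * indicator (overweight_shell (a k)) x \<partial>lborel)
      \<le> ennreal (5 * M * a k) * (ennreal (16 * exp (- a k / (32 * M))) * ?H)"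
      using ak M dim by (intro mult_left_mono nn_integral_overweight_shell_le) auto
    also have "\<dots> = ennreal (5 * M * a k * (16 * exp (- a k / (32 * M)))) * ?H"
      by (subst mult.assoc[symmetric], subst ennreal_mult[symmetric]) (use ak M in auto)
    also have "\<dots> \<le> ennreal (1280 * M\<^sup>2 * (1 / 2) ^ k) * ?H"
      by (intro mult_right_mono ennreal_leI const) auto
    finally show ?thesis .
  qed
  have MR: "0 \<le> M * R" using M R by simp
  have C0: "C \<ge> 0" using MR by (simp add: C_def)
  have "(\<integral>\<^sup>+x. ennreal (bregman_entropy (f x) (g x)) \<partial>lborel)
      \<le> (\<integral>\<^sup>+x. ennreal (C * D x) + (\<Sum>k. ennreal (5 * M * a k)
            * (ennreal (f x) * indicator (overweight_shell (a k)) x)) \<partial>lborel)"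
    unfolding C_def D_def using R M
    by (intro nn_integral_mono bregman_entropy_mixture_le) (auto simp: a_def)
  also have "\<dots> = (\<integral>\<^sup>+x. ennreal (C * D x) \<partial>lborel)
      + (\<Sum>k. ennreal (5 * M * a k)
            * (\<integral>\<^sup>+x. ennreal (f x) * indicator (overweight_shell (a k)) x \<partial>lborel))"
    by (simp add: nn_integral_add nn_integral_suminf nn_integral_cmult)
  also have "\<dots> \<le> ennreal C * ?H + (\<Sum>k. ennreal (1280 * M\<^sup>2 * (1 / 2) ^ k) * ?H)"
    using C0 by (intro add_mono suminf_le shell)
      (auto simp: ennreal_mult nn_integral_cmult hellinger_sq_def D_def)
  also have "(\<Sum>k. ennreal (1280 * M\<^sup>2 * (1 / 2) ^ k) * ?H)
      = (\<Sum>k. ennreal (1280 * M\<^sup>2 * (1 / 2) ^ k)) * ?H"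
    by simp
  also have "(\<Sum>k. ennreal (1280 * M\<^sup>2 * (1 / 2) ^ k)) = ennreal (1280 * M\<^sup>2 * 2)"
    using sums_mult[OF geometric_sums[of "1 / 2 :: real"], of "1280 * M\<^sup>2"]
    by (intro suminf_ennreal_eq) auto
  also have "ennreal C * ?H + ennreal (1280 * M\<^sup>2 * 2) * ?H = ennreal (C + 2560 * M\<^sup>2) * ?H"
    using C0 by (simp add: ennreal_plus distrib_right)
  also have "\<dots> \<le> ennreal (5154 * m\<^sup>2) * ?H"
  proof (intro mult_right_mono ennreal_leI)
    have "M * m \<le> m\<^sup>2" using Mm M by (simp add: power2_eq_square mult_right_mono)
    moreover have "2\<^sup>2 \<le> M\<^sup>2" using M by (intro power_mono) auto
    ultimately show "C + 2560 * M\<^sup>2 \<le> 5154 * m\<^sup>2"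
      using \<open>M\<^sup>2 \<le> m\<^sup>2\<close> by (simp add: C_def R_def)
  qed auto
  finally show ?thesis .
qed

end

theorem theorem1:
  fixes \<pi> \<eta> :: "(real ^ 'd) measure"
    and M :: real
  assumes "M \<ge> 2"
    and "prob_space \<pi>" and "sets \<pi> = sets borel" and "AE x in \<pi>. x \<in> cball 0 M"
    and "prob_space \<eta>" and "sets \<eta> = sets borel" and "AE x in \<eta>. x \<in> cball 0 M"
  shows "KL (gauss_mixture \<pi>) (gauss_mixture \<eta>)
    \<le> ereal (5154 * max (M\<^sup>2) (real CARD('d)))
        * enn2ereal (hellinger_sq (gauss_mixture \<pi>) (gauss_mixture \<eta>))"
proof -
  interpret mixture_pair \<pi> \<eta> M
    using assms
    by (simp add: mixture_pair_def mixture_pair_axioms_def bounded_mixing_distribution_def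
        bounded_mixing_distribution_axioms_def)
  define m where "m = sqrt (max (M\<^sup>2) (real CARD('d)))"
  have m: "m\<^sup>2 = max (M\<^sup>2) (real CARD('d))" "m \<ge> 0" by (auto simp: m_def le_max_iff_disj)
  have "KL f g = enn2ereal (\<integral>\<^sup>+x. ennreal (bregman_entropy (f x) (g x)) \<partial>lborel)"
    by (intro KL_eq_nn_integral_bregman_entropy P.borel_measurable_gauss_mixture
        E.borel_measurable_gauss_mixture P.gauss_mixture_pos E.gauss_mixture_pos
        P.nn_integral_gauss_mixture E.nn_integral_gauss_mixture)
  also have "\<dots> \<le> enn2ereal (ennreal (5154 * m\<^sup>2) * hellinger_sq f g)"
    using nn_integral_bregman_entropy_mixture_le[of m] m by (simp add: less_eq_ennreal.rep_eq[symmetric])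
  also have "\<dots> = ereal (5154 * m\<^sup>2) * enn2ereal (hellinger_sq f g)"
    by (simp add: times_ennreal.rep_eq)
  finally show ?thesis by (simp only: m)
qed

end
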